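(* Let $\mathcal{A}$ be an associative $R$-algebra and let $\vartheta$ be any of the types "left", "right", "pre-two-sided", "two-sided". Then $\mathcal{E}_{\vartheta}(\mathcal{A})$ is exactly the set of those $V \in \mathcal{G}_{\vartheta}(\mathcal{A})$ that are uniform $\vartheta$-Mathieu subspaces of $\mathcal{A}$.
   Context: $R$ is a commutative ring with unity and $\mathcal{A}$ is a unital associative (not necessarily commutative) $R$-algebra; an $R$-subspace is an $R$-submodule. An $R$-subspace $M$ of $\mathcal{A}$ is a $\vartheta$-Mathieu subspace if for all $a,b,c\in\mathcal{A}$ with $a^m \in M$ for all $m\ge 1$, one has for all sufficiently large $m$: $ba^m\in M$ if $\vartheta$ = left; $a^mc\in M$ if $\vartheta$ = right; $ba^m, a^mc\in M$ if $\vartheta$ = pre-two-sided; $ba^mc\in M$ if $\vartheta$ = two-sided (how large $m$ must be may depend on $a,b,c$). For $S\subseteq\mathcal{A}$, $(S)_\vartheta$ denotes the left, right, or two-sided ideal of $\mathcal{A}$ generated by $S$ if $\vartheta$ = left, right, two-sided respectively, and $(S)_{\text{pre-two-sided}}$ is the sum of the left ideal and the right ideal generated by $S$. Write $(a)_\vartheta=(\{a\})_\vartheta$ and $(e\in V\mid e^2=e)_\vartheta$ for $(\{e\in V\mid e^2=e\})_\vartheta$. An $R$-subspace $M$ is a uniform $\vartheta$-Mathieu subspace if for all $a\in\mathcal{A}$ with $a^m\in M$ for all $m\ge1$, there is $N\in\mathbb{N}$ with $(a^N)_\vartheta\subseteq M$. For $V \subseteq\mathcal{A}$, $\mathfrak{r}(V)=\{a\in\mathcal{A}\mid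 a^m\in V \text{ for all sufficiently large } m\}$. For $\vartheta\ne$ pre-two-sided, $\mathcal{G}_\vartheta(\mathcal{A})$ is the set of all $R$-subspaces $V$ of $\mathcal{A}$ with $\mathfrak{r}(V)\subseteq\mathfrak{r}\big((e\in V\mid e^2=e)_\vartheta\big)$; and $\mathcal{G}_{\text{pre-two-sided}}(\mathcal{A})=\mathcal{G}_{\text{left}}(\mathcal{A})\cap\mathcal{G}_{\text{right}}(\mathcal{A})$. $\mathcal{E}_\vartheta(\mathcal{A})$ is the set of all $V\in\mathcal{G}_\vartheta(\mathcal{A})$ that are $\vartheta$-Mathieu subspaces of $\mathcal{A}$. *)

theory Defs
  imports "HOL-Algebra.Algebra"
begin

text \<open>
  The library locale \<^locale>\<open>algebra\<close> requires the algebra to be commutative. Here multiplication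
  in \<open>M\<close> may be noncommutative, so bilinearity has to be required in both factors. The zero
  algebra is allowed.
\<close>

locale assoc_algebra = module + ring M +
  assumes smult_mult_left:
      "\<lbrakk>r \<in> carrier R; x \<in> carrier M; y \<in> carrier M\<rbrakk> \<Longrightarrow>
      (r \<odot>\<^bsub>M\<^esub> x) \<otimes>\<^bsub>M\<^esub> y = r \<odot>\<^bsub>M\<^esub> (x \<otimes>\<^bsub>M\<^esub> y)"
    and smult_mult_right:
      "\<lbrakk>r \<in> carrier R; x \<in> carrier M; y \<in> carrier M\<rbrakk> \<Longrightarrow>
      x \<otimes>\<^bsub>M\<^esub> (r \<odot>\<^bsub>M\<^esub> y) = r \<odot>\<^bsub>M\<^esub> (x \<otimes>\<^bsub>M\<^esub> y)"

datatype side = Left | Right | PreTwoSided | TwoSided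

definition left_ideal :: "'a set \<Rightarrow> ('a, 'n) ring_scheme \<Rightarrow> bool" where
  "left_ideal I A \<longleftrightarrow> additive_subgroup I A \<and>
     (\<forall>x\<in>carrier A. \<forall>y\<in>I. x \<otimes>\<^bsub>A\<^esub> y \<in> I)"

definition right_ideal :: "'a set \<Rightarrow> ('a, 'n) ring_scheme \<Rightarrow> bool" where
  "right_ideal I A \<longleftrightarrow> additive_subgroup I A \<and>
     (\<forall>x\<in>carrier A. \<forall>y\<in>I. y \<otimes>\<^bsub>A\<^esub> x \<in> I)"

definition gen_left_ideal :: "('a, 'n) ring_scheme \<Rightarrow> 'a set \<Rightarrow> 'a set" where
  "gen_left_ideal A S = \<Inter>{I. left_ideal I A \<and> S \<subseteq> I}"

definition gen_right_ideal :: "('a, 'n) ring_scheme \<Rightarrow> 'a set \<Rightarrow> 'a set" where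
  "gen_right_ideal A S = \<Inter>{I. right_ideal I A \<and> S \<subseteq> I}"

text \<open>
  \<open>gen \<theta> A S\<close> is $(S)_\vartheta$. Since the algebra is unital and bilinear over the base ring, one-
  and two-sided ideals of the ring \<open>A\<close> are automatically closed under scalars.
\<close>

fun gen :: "side \<Rightarrow> ('a, 'n) ring_scheme \<Rightarrow> 'a set \<Rightarrow> 'a set" where
  "gen Left A S = gen_left_ideal A S"
| "gen Right A S = gen_right_ideal A S"
| "gen PreTwoSided A S = gen_left_ideal A S <+>\<^bsub>A\<^esub> gen_right_ideal A S"
| "gen TwoSided A S = Idl\<^bsub>A\<^esub> S"

fun absorbed :: "side \<Rightarrow> ('a, 'n) ring_scheme \<Rightarrow> 'a set \<Rightarrow> 'a \<Rightarrow> 'a \<Rightarrow> 'a \<Rightarrow> bool" where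
  "absorbed Left A M b x c \<longleftrightarrow> b \<otimes>\<^bsub>A\<^esub> x \<in> M"
| "absorbed Right A M b x c \<longleftrightarrow> x \<otimes>\<^bsub>A\<^esub> c \<in> M"
| "absorbed PreTwoSided A M b x c \<longleftrightarrow> b \<otimes>\<^bsub>A\<^esub> x \<in> M \<and> x \<otimes>\<^bsub>A\<^esub> c \<in> M"
| "absorbed TwoSided A M b x c \<longleftrightarrow> b \<otimes>\<^bsub>A\<^esub> x \<otimes>\<^bsub>A\<^esub> c \<in> M"

definition mathieu_subspace ::
  "side \<Rightarrow> ('r, 'm) ring_scheme \<Rightarrow> ('r, 'a, 'n) module_scheme \<Rightarrow> 'a set \<Rightarrow> bool" where
  "mathieu_subspace \<theta> R A M \<longleftrightarrow> submodule M R A \<and>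
     (\<forall>a\<in>carrier A. \<forall>b\<in>carrier A. \<forall>c\<in>carrier A.
        (\<forall>m::nat. m \<ge> 1 \<longrightarrow> a [^]\<^bsub>A\<^esub> m \<in> M) \<longrightarrow>
        (\<forall>\<^sub>F m::nat in sequentially. absorbed \<theta> A M b (a [^]\<^bsub>A\<^esub> m) c))"

definition uniform_mathieu_subspace ::
  "side \<Rightarrow> ('r, 'm) ring_scheme \<Rightarrow> ('r, 'a, 'n) module_scheme \<Rightarrow> 'a set \<Rightarrow> bool" where
  "uniform_mathieu_subspace \<theta> R A M \<longleftrightarrow> submodule M R A \<and>
     (\<forall>a\<in>carrier A. (\<forall>m::nat. m \<ge> 1 \<longrightarrow> a [^]\<^bsub>A\<^esub> m \<in> M) \<longrightarrow>
        (\<exists>N::nat. gen \<theta> A {a [^]\<^bsub>A\<^esub> N} \<subseteq> M))"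

definition radical :: "('a, 'n) ring_scheme \<Rightarrow> 'a set \<Rightarrow> 'a set" where
  "radical A V = {a \<in> carrier A. \<forall>\<^sub>F m::nat in sequentially. a [^]\<^bsub>A\<^esub> m \<in> V}"

definition idempotents_in :: "('a, 'n) ring_scheme \<Rightarrow> 'a set \<Rightarrow> 'a set" where
  "idempotents_in A V = {e \<in> V. e \<otimes>\<^bsub>A\<^esub> e = e}"

definition radical_idem_subspaces ::
  "side \<Rightarrow> ('r, 'm) ring_scheme \<Rightarrow> ('r, 'a, 'n) module_scheme \<Rightarrow> 'a set set" where
  "radical_idem_subspaces \<theta> R A =
     {V. submodule V R A \<and> radical A V \<subseteq> radical A (gen \<theta> A (idempotents_in A V))}"

text \<open>
  In the pre-two-sided case \<open>G_class\<close> ($\mathcal{G}_\vartheta$) is the intersection of the left and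
  the right class; it is not obtained by using the pre-two-sided \<^const>\<open>gen\<close> in the inclusion.
\<close>

fun G_class ::
  "side \<Rightarrow> ('r, 'm) ring_scheme \<Rightarrow> ('r, 'a, 'n) module_scheme \<Rightarrow> 'a set set" where
  "G_class Left R A = radical_idem_subspaces Left R A"
| "G_class Right R A = radical_idem_subspaces Right R A"
| "G_class PreTwoSided R A = radical_idem_subspaces Left R A \<inter> radical_idem_subspaces Right R A"
| "G_class TwoSided R A = radical_idem_subspaces TwoSided R A"

definition E_class ::
  "side \<Rightarrow> ('r, 'm) ring_scheme \<Rightarrow> ('r, 'a, 'n) module_scheme \<Rightarrow> 'a set set" where
  "E_class \<theta> R A = {V \<in> G_class \<theta> R A. mathieu_subspace \<theta> R A V}"

end

theory Submission
  imports Defs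
begin

text \<open>
  For a submodule \<open>V\<close> and a type \<open>\<theta>\<close> let the core of \<open>V\<close> be the set of all \<open>x\<close> that are absorbed
  into \<open>V\<close> by every choice of multipliers, for instance \<open>{x. A x \<subseteq> V}\<close> on the left. Apart from
  the pre-two-sided type, the core is the largest \<open>\<theta>\<close>-ideal inside \<open>V\<close>, and for all four types
  the ideal \<open>(x)\<^sub>\<theta>\<close> lies in \<open>V\<close> exactly when \<open>x\<close> lies in the core. In these terms both
  properties concern an element \<open>a\<close> whose positive powers lie in \<open>V\<close>: the Mathieu property says
  that for each fixed pair of multipliers the high powers of \<open>a\<close> are absorbed, and uniformity says
  that some power \<open>a\<^sup>N\<close> lies in the core.

  Uniformity implies the Mathieu property because a power beyond \<open>a\<^sup>N\<close> is a multiple of \<open>a\<^sup>N\<close> on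
  either side, and the additional factor can be merged into the multipliers.

  For the converse, the dependence of the exponent on the multipliers must be removed. It is
  harmless for an idempotent \<open>e\<close> of \<open>V\<close>: all its positive powers equal \<open>e\<close>, so the Mathieu property
  puts \<open>e\<close> itself into the core. As the core is an ideal, it contains the ideal generated by all
  idempotents of \<open>V\<close>. The assumption on radicals that defines \<open>\<G>\<^sub>\<theta>\<close> says that this ideal
  contains all high powers of \<open>a\<close>, and so the core contains one of them. In the pre-two-sided
  case the left and the right radical assumptions are used together: a power that is high enough
  for both lies in the left and in the right core.
\<close>

section \<open>The core of a subspace\<close>

definition core :: "side \<Rightarrow> ('a, 'n) ring_scheme \<Rightarrow> 'a set \<Rightarrow> 'a set" where
  "core \<theta> A V = {x \<in> carrier A. \<forall>b\<in>carrier A. \<forall>c\<in>carrier A. absorbed \<theta> A V b x c}"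

lemma core_subset_carrier: "core \<theta> A V \<subseteq> carrier A"
  by (auto simp: core_def)

lemma core_PreTwoSided: "core PreTwoSided A V = core Left A V \<inter> core Right A V"
  by (auto simp: core_def)

lemma submodule_imp_additive_subgroup:
  "submodule V R A \<Longrightarrow> additive_subgroup V A"
  by (simp add: submodule_def additive_subgroup_def)

context ring
begin

lemma core_subset: "core \<theta> R V \<subseteq> V"
proof
  fix x assume x: "x \<in> core \<theta> R V"
  then have "x \<in> carrier R" "absorbed \<theta> R V \<one> x \<one>"
    by (auto simp: core_def)
  then show "x \<in> V"
    by (cases \<theta>) simp_all
qed

lemma additive_subgroup_core:
  assumes "additive_subgroup V R"
  shows "additive_subgroup (core \<theta> R V) R"
proof -
  interpret V: additive_subgroup V R by fact
  have "subgroup (core \<theta> R V) (add_monoid R)"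
  proof (rule add.subgroupI)
    show "core \<theta> R V \<subseteq> carrier R"
      by (rule core_subset_carrier)
    have "\<zero> \<in> core \<theta> R V"
      by (cases \<theta>) (simp_all add: core_def)
    then show "core \<theta> R V \<noteq> {}"
      by blast
    show "\<ominus> x \<in> core \<theta> R V" if "x \<in> core \<theta> R V" for x
      using that by (cases \<theta>) (simp_all add: core_def l_minus r_minus)
    show "x \<oplus> y \<in> core \<theta> R V" if "x \<in> core \<theta> R V" "y \<in> core \<theta> R V" for x y
      using that by (cases \<theta>) (simp_all add: core_def l_distr r_distr)
  qed
  then show ?thesis
    by (rule additive_subgroup.intro)
qed

lemma left_ideal_core:
  assumes "additive_subgroup V R"
  shows "left_ideal (core Left R V) R"
  unfolding left_ideal_def
  proof (intro conjI ballI)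
  fix x y assume "x \<in> carrier R" "y \<in> core Left R V"
  then show "x \<otimes> y \<in> core Left R V"
    by (auto simp: core_def simp flip: m_assoc)
qed (rule additive_subgroup_core[OF assms])

lemma right_ideal_core:
  assumes "additive_subgroup V R"
  shows "right_ideal (core Right R V) R"
  unfolding right_ideal_def
  proof (intro conjI ballI)
  fix x y assume "x \<in> carrier R" "y \<in> core Right R V"
  then show "y \<otimes> x \<in> core Right R V"
    by (auto simp: core_def m_assoc)
qed (rule additive_subgroup_core[OF assms])

lemma ideal_core:
  assumes "additive_subgroup V R"
  shows "ideal (core TwoSided R V) R"
proof (rule idealI[OF ring_axioms])
  show "subgroup (core TwoSided R V) (add_monoid R)"
    using additive_subgroup_core[OF assms] by (rule additive_subgroup.a_subgroup)
  fix a x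
  assume a: "a \<in> core TwoSided R V" and x: "x \<in> carrier R"
  have aR: "a \<in> carrier R"
    and abs: "\<And>b c. b \<in> carrier R \<Longrightarrow> c \<in> carrier R \<Longrightarrow> b \<otimes> a \<otimes> c \<in> V"
    using a by (auto simp: core_def)
  show "x \<otimes> a \<in> core TwoSided R V"
    using abs aR x by (simp add: core_def flip: m_assoc)
  have "b \<otimes> (a \<otimes> x) \<otimes> c \<in> V" if "b \<in> carrier R" "c \<in> carrier R" for b c
    using abs[of b "x \<otimes> c"] aR x that by (simp add: m_assoc)
  then show "a \<otimes> x \<in> core TwoSided R V"
    using aR x by (simp add: core_def)
qed

text \<open>
  The core is one of the ideals over which the intersection defining \<open>(S)\<^sub>\<theta>\<close> is taken. The
  argument breaks down for the pre-two-sided type, whose core is the intersection of a left and a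
  right ideal and in general neither of the two.
\<close>

lemma gen_subset_core:
  assumes "additive_subgroup V R" "\<theta> \<noteq> PreTwoSided" "S \<subseteq> core \<theta> R V"
  shows "gen \<theta> R S \<subseteq> core \<theta> R V"
proof (cases \<theta>)
  case Left
  then show ?thesis
    using assms left_ideal_core[of V] by (auto simp: gen_left_ideal_def)
next
  case Right
  then show ?thesis
    using assms right_ideal_core[of V] by (auto simp: gen_right_ideal_def)
next
  case TwoSided
  then show ?thesis
    using assms ideal_core[of V] genideal_minimal by simp
qed (use assms in simp)

lemma one_sided_subset_gen_PreTwoSided:
  assumes "S \<subseteq> carrier R"
  shows "gen Left R S \<subseteq> gen PreTwoSided R S" "gen Right R S \<subseteq> gen PreTwoSided R S"
proof -
  have R: "left_ideal (carrier R) R" "right_ideal (carrier R) R"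
    by (auto simp: left_ideal_def right_ideal_def additive_subgroup_def
        add.subgroup_self)
  have sub: "gen_left_ideal R S \<subseteq> carrier R" "gen_right_ideal R S \<subseteq> carrier R"
    using R assms by (auto simp: gen_left_ideal_def gen_right_ideal_def)
  have zero: "\<zero> \<in> gen_left_ideal R S" "\<zero> \<in> gen_right_ideal R S"
    by (auto simp: gen_left_ideal_def gen_right_ideal_def left_ideal_def right_ideal_def
        additive_subgroup.zero_closed)
  show "gen Left R S \<subseteq> gen PreTwoSided R S"
  proof
    fix x assume x: "x \<in> gen Left R S"
    then have "x = x \<oplus> \<zero>"
      using sub by auto
    then show "x \<in> gen PreTwoSided R S"
      using x zero by (force simp: set_add_def')
  qed
  show "gen Right R S \<subseteq> gen PreTwoSided R S"
  proof
    fix x assume x: "x \<in> gen Right R S"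
    then have "x = \<zero> \<oplus> x"
      using sub by auto
    then show "x \<in> gen PreTwoSided R S"
      using x zero by (force simp: set_add_def')
  qed
qed

section \<open>Generated ideals inside a subspace\<close>

text \<open>
  This translates uniformity, which speaks of generated ideals, into absorption, the language of
  the Mathieu property.
\<close>

lemma gen_subset_iff:
  assumes V: "additive_subgroup V R" and S: "S \<subseteq> carrier R"
  shows "gen \<theta> R S \<subseteq> V \<longleftrightarrow> S \<subseteq> core \<theta> R V"
proof
  assume gen: "gen \<theta> R S \<subseteq> V"
  have left: "b \<otimes> x \<in> gen Left R S" if "b \<in> carrier R" "x \<in> S" for b x
    using that by (auto simp: gen_left_ideal_def left_ideal_def)
  have right: "x \<otimes> c \<in> gen Right R S" if "c \<in> carrier R" "x \<in> S" for c x
    using that by (auto simp: gen_right_ideal_def right_ideal_def)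
  have two: "b \<otimes> x \<otimes> c \<in> gen TwoSided R S"
    if "b \<in> carrier R" "c \<in> carrier R" "x \<in> S" for b c x
    using that genideal_ideal[OF S] genideal_self[OF S]
    by (simp add: ideal.I_l_closed ideal.I_r_closed subsetD)
  have pre: "gen Left R S \<subseteq> V" "gen Right R S \<subseteq> V" if "\<theta> = PreTwoSided"
    using order_trans[OF one_sided_subset_gen_PreTwoSided(1)[OF S] gen[unfolded that]]
      order_trans[OF one_sided_subset_gen_PreTwoSided(2)[OF S] gen[unfolded that]] .
  have "absorbed \<theta> R V b x c" if "x \<in> S" "b \<in> carrier R" "c \<in> carrier R" for x b c
  proof -
    note mult = left[OF that(2,1)] right[OF that(3,1)] two[OF that(2,3,1)]
    show ?thesis
    proof (cases \<theta>)
      case Left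
      then show ?thesis using subsetD[OF gen] mult(1) by simp
    next
      case Right
      then show ?thesis using subsetD[OF gen] mult(2) by simp
    next
      case PreTwoSided
      then show ?thesis using subsetD[OF pre(1) mult(1)] subsetD[OF pre(2) mult(2)] by simp
    next
      case TwoSided
      then show ?thesis using subsetD[OF gen] mult(3) by simp
    qed
  qed
  then show "S \<subseteq> core \<theta> R V"
    using S by (auto simp: core_def)
next
  interpret V: additive_subgroup V R by fact
  assume core: "S \<subseteq> core \<theta> R V"
  show "gen \<theta> R S \<subseteq> V"
  proof (cases "\<theta> = PreTwoSided")
    case True
    have "S \<subseteq> core Left R V" "S \<subseteq> core Right R V"
      using core True by (simp_all add: core_PreTwoSided)
    then have "gen Left R S \<subseteq> core Left R V" "gen Right R S \<subseteq> core Right R V"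
      by (intro gen_subset_core[OF V]; simp)+
    then have "gen Left R S \<subseteq> V" "gen Right R S \<subseteq> V"
      using core_subset order_trans by blast+
    then show ?thesis
      using True V.a_closed by (auto simp: set_add_def')
  next
    case False
    then show ?thesis
      using gen_subset_core[OF V False core] core_subset by blast
  qed
qed

lemma absorbed_pow_if_core:
  assumes a: "a \<in> carrier R" and N: "a [^] (N::nat) \<in> core \<theta> R V" and "N \<le> m"
    and bc: "b \<in> carrier R" "c \<in> carrier R"
  shows "absorbed \<theta> R V b (a [^] m) c"
proof -
  define k where "k = m - N"
  have l: "a [^] m = a [^] k \<otimes> a [^] N" and r: "a [^] m = a [^] N \<otimes> a [^] k"
    using a \<open>N \<le> m\<close> by (simp_all add: k_def nat_pow_mult)
  have bl: "b \<otimes> a [^] m = (b \<otimes> a [^] k) \<otimes> a [^] N"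
    using a bc l by (simp add: m_assoc)
  have cr: "a [^] m \<otimes> c = a [^] N \<otimes> (a [^] k \<otimes> c)"
    using a bc r by (simp add: m_assoc)
  show ?thesis
    using N a bc by (cases \<theta>) (auto simp: core_def bl cr)
qed

lemma idempotent_nat_pow:
  assumes "e \<in> carrier R" "e \<otimes> e = e" "m \<ge> 1"
  shows "e [^] (m::nat) = e"
  using assms(3) by (induction m rule: dec_induct) (use assms in simp_all)

end

section \<open>Mathieu and uniform Mathieu subspaces\<close>

lemma uniform_imp_mathieu:
  assumes "ring A" and unif: "uniform_mathieu_subspace \<theta> R A V"
  shows "mathieu_subspace \<theta> R A V"
  unfolding mathieu_subspace_def
proof (intro conjI ballI impI)
  interpret ring A by fact
  show V: "submodule V R A"
    using unif by (simp add: uniform_mathieu_subspace_def)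
  fix a b c
  assume a: "a \<in> carrier A" and bc: "b \<in> carrier A" "c \<in> carrier A"
    and pow: "\<forall>m::nat. m \<ge> 1 \<longrightarrow> a [^]\<^bsub>A\<^esub> m \<in> V"
  obtain N :: nat where "gen \<theta> A {a [^]\<^bsub>A\<^esub> N} \<subseteq> V"
    using unif a pow unfolding uniform_mathieu_subspace_def by blast
  then have "a [^]\<^bsub>A\<^esub> N \<in> core \<theta> A V"
    using gen_subset_iff[OF submodule_imp_additive_subgroup[OF V]] a by simp
  then show "\<forall>\<^sub>F m in sequentially. absorbed \<theta> A V b (a [^]\<^bsub>A\<^esub> m) c"
    using absorbed_pow_if_core[OF a _ _ bc] unfolding eventually_sequentially by blast
qed

lemma idempotents_subset_core:
  assumes "ring A" and M: "mathieu_subspace \<theta> R A V"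
  shows "idempotents_in A V \<subseteq> core \<theta> A V"
proof
  interpret ring A by fact
  interpret V: additive_subgroup V A
    using M by (auto simp: mathieu_subspace_def intro: submodule_imp_additive_subgroup)
  fix e assume "e \<in> idempotents_in A V"
  then have e: "e \<in> V" "e \<in> carrier A" "e \<otimes>\<^bsub>A\<^esub> e = e"
    using V.a_subset by (auto simp: idempotents_in_def)
  have pow: "e [^]\<^bsub>A\<^esub> m = e" if "m \<ge> 1" for m :: nat
    using e that by (simp add: idempotent_nat_pow)
  have "absorbed \<theta> A V b e c" if bc: "b \<in> carrier A" "c \<in> carrier A" for b c
  proof -
    have "\<forall>\<^sub>F m::nat in sequentially. absorbed \<theta> A V b (e [^]\<^bsub>A\<^esub> m) c"
      using M e bc pow unfolding mathieu_subspace_def by simp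
    then obtain N :: nat where "\<forall>m\<ge>N. absorbed \<theta> A V b (e [^]\<^bsub>A\<^esub> m) c"
      unfolding eventually_sequentially by blast
    then show ?thesis
      using pow[of "Suc N"] by (metis le_add1 le_add2 plus_1_eq_Suc)
  qed
  then show "e \<in> core \<theta> A V"
    using e by (simp add: core_def)
qed

text \<open>
  High powers of \<open>a\<close> lie in the ideal generated by the idempotents of \<open>V\<close> by the radical inclusion,
  and that ideal lies in the core. The pre-two-sided class \<open>\<G>\<close> has no radical inclusion of
  its own; that type is reached by using the left and the right instance together.
\<close>

lemma eventually_pow_in_core:
  assumes "ring A" "\<theta> \<noteq> PreTwoSided" and G: "V \<in> radical_idem_subspaces \<theta> R A"
    and E: "idempotents_in A V \<subseteq> core \<theta> A V"
    and a: "a \<in> carrier A" and pow: "\<forall>m::nat. m \<ge> 1 \<longrightarrow> a [^]\<^bsub>A\<^esub> m \<in> V"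
  shows "\<forall>\<^sub>F m::nat in sequentially. a [^]\<^bsub>A\<^esub> m \<in> core \<theta> A V"
proof -
  interpret ring A by fact
  have V: "additive_subgroup V A"
    using G by (auto simp: radical_idem_subspaces_def intro: submodule_imp_additive_subgroup)
  have "a \<in> radical A V"
    using a pow by (auto simp: radical_def eventually_sequentially)
  then have "\<forall>\<^sub>F m::nat in sequentially. a [^]\<^bsub>A\<^esub> m \<in> gen \<theta> A (idempotents_in A V)"
    using G by (auto simp: radical_idem_subspaces_def radical_def)
  then show ?thesis
    by (rule eventually_mono) (use gen_subset_core[OF V \<open>\<theta> \<noteq> PreTwoSided\<close> E] in blast)
qed

lemma mathieu_imp_uniform:
  assumes "ring A" and G: "V \<in> G_class \<theta> R A" and M: "mathieu_subspace \<theta> R A V"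
  shows "uniform_mathieu_subspace \<theta> R A V"
  unfolding uniform_mathieu_subspace_def
proof (intro conjI ballI impI)
  interpret ring A by fact
  show V: "submodule V R A"
    using M by (simp add: mathieu_subspace_def)
  fix a
  assume a: "a \<in> carrier A" and pow: "\<forall>m::nat. m \<ge> 1 \<longrightarrow> a [^]\<^bsub>A\<^esub> m \<in> V"
  note E = idempotents_subset_core[OF \<open>ring A\<close> M]
  have "\<forall>\<^sub>F m::nat in sequentially. a [^]\<^bsub>A\<^esub> m \<in> core \<theta> A V"
  proof (cases "\<theta> = PreTwoSided")
    case True
    have "\<forall>\<^sub>F m::nat in sequentially. a [^]\<^bsub>A\<^esub> m \<in> core Left A V"
      by (rule eventually_pow_in_core[OF \<open>ring A\<close> _ _ _ a pow])
        (use G E True in \<open>auto simp: core_PreTwoSided\<close>)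
    moreover have "\<forall>\<^sub>F m::nat in sequentially. a [^]\<^bsub>A\<^esub> m \<in> core Right A V"
      by (rule eventually_pow_in_core[OF \<open>ring A\<close> _ _ _ a pow])
        (use G E True in \<open>auto simp: core_PreTwoSided\<close>)
    ultimately show ?thesis
      unfolding True core_PreTwoSided Int_iff by (rule eventually_conj)
  next
    case False
    moreover from this have "V \<in> radical_idem_subspaces \<theta> R A"
      using G by (cases \<theta>) simp_all
    ultimately show ?thesis
      using eventually_pow_in_core[OF \<open>ring A\<close> _ _ E a pow] by blast
  qed
  then obtain N :: nat where "a [^]\<^bsub>A\<^esub> N \<in> core \<theta> A V"
    unfolding eventually_sequentially by blast
  then show "\<exists>N::nat. gen \<theta> A {a [^]\<^bsub>A\<^esub> N} \<subseteq> V"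
    using gen_subset_iff[OF submodule_imp_additive_subgroup[OF V]] a by auto
qed

theorem theorem3p9:
  fixes R :: "('r, 'm) ring_scheme" and A :: "('r, 'a, 'n) module_scheme" and \<theta> :: side
  assumes "assoc_algebra R A"
  shows "E_class \<theta> R A = {V \<in> G_class \<theta> R A. uniform_mathieu_subspace \<theta> R A V}"
proof -
  have "ring A"
    using assms by (rule assoc_algebra.axioms)
  then show ?thesis
    unfolding E_class_def using uniform_imp_mathieu mathieu_imp_uniform by blast
qed

end
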